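(* Let $R$ be a ring, $n\ge1$, and let $T=[t_{i,j}]$ be a matrix in $\mathrm{M}_n(\mathrm{Z}(R))$, where $\mathrm{Z}(R)$ denotes the center of $R$. The following conditions are equivalent: (1) $T$ is transitive; (2) the map $\Theta_T:\mathrm{M}_n(R)\to\mathrm{M}_n(R)$, $\Theta_T(A)=T\ast A$ (Hadamard multiplication by $T$), is an automorphism of the matrix algebra $\mathrm{M}_n(R)$ over $\mathrm{Z}(R)$.
   Context: A ring means a not necessarily commutative ring with identity; endomorphisms preserve the identity. $\mathrm{M}_n(R)$ is the ring of $n\times n$ matrices over $R$. A matrix $T=[t_{i,j}]$ is transitive if $t_{i,i}=1$ and $t_{i,j}t_{j,k}=t_{i,k}$ for all $i,j,k\in\{1,\ldots,n\}$. The Hadamard product of $A=[a_{i,j}]$ and $B=[b_{i,j}]$ in $\mathrm{M}_n(R)$ is $A\ast B=[a_{i,j}b_{i,j}]$. *)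

theory Defs
  imports "HOL-Algebra.QuotRing" "Jordan_Normal_Form.Matrix"
begin

text \<open>
  Unital rings are rendered by the sort \<open>{ring, monoid_mult}\<close> rather than by \<open>ring_1\<close>, because the
  latter has the axiom \<open>0 \<noteq> 1\<close> and would exclude the zero ring. For the same reason the library's
  \<open>ring_mat\<close> and \<open>module_mat\<close>, which demand \<open>semiring_1\<close>, are not available; the operations on
  matrices themselves do exist at this sort.
\<close>

definition ring_center :: "'a :: {ring, monoid_mult} set" where
  "ring_center = {z. \<forall>x. z * x = x * z}"

definition matrix_algebra ::
  "'a :: {ring, monoid_mult} itself \<Rightarrow> nat \<Rightarrow> ('a, 'a mat) module" where
  "matrix_algebra ty n = \<lparr>
    carrier = carrier_mat n n,
    monoid.mult = (*),
    one = 1\<^sub>m n,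
    zero = 0\<^sub>m n n,
    add = (+),
    smult = (\<cdot>\<^sub>m)\<rparr>"

text \<open>
  The locale \<open>algebra\<close> of the library requires the algebra itself to be commutative, so automorphisms
  of an algebra are described through \<open>ring_iso\<close> (whose members preserve the identity) and
  compatibility with a set \<open>K\<close> of scalars.
\<close>

definition algebra_automorphism ::
  "'k set \<Rightarrow> ('k, 'm, 'z) module_scheme \<Rightarrow> ('m \<Rightarrow> 'm) \<Rightarrow> bool" where
  "algebra_automorphism K M f \<longleftrightarrow>
     f \<in> ring_iso M M \<and>
     (\<forall>c\<in>K. \<forall>A\<in>carrier M. f (c \<odot>\<^bsub>M\<^esub> A) = c \<odot>\<^bsub>M\<^esub> f A)"

definition transitive_mat :: "'a :: {ring, monoid_mult} mat \<Rightarrow> bool" where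
  "transitive_mat T \<longleftrightarrow>
     square_mat T \<and>
     (\<forall>i<dim_row T. T $$ (i, i) = 1) \<and>
     (\<forall>i<dim_row T. \<forall>j<dim_row T. \<forall>k<dim_row T. T $$ (i, j) * T $$ (j, k) = T $$ (i, k))"

definition hadamard :: "'a :: times mat \<Rightarrow> 'a mat \<Rightarrow> 'a mat" where
  "hadamard A B = mat (dim_row A) (dim_col A) (\<lambda>ij. A $$ ij * B $$ ij)"

end

theory Submission
  imports Defs
begin

text \<open>
  Transitivity gives \<open>t\<^bsub>ij\<^esub> t\<^bsub>ji\<^esub> = 1\<close>, so Hadamard multiplication by the transpose of \<open>T\<close> inverts
  \<open>\<Theta>\<^sub>T\<close>; multiplicativity of \<open>\<Theta>\<^sub>T\<close> is \<open>t\<^bsub>ik\<^esub> a\<^bsub>ij\<^esub> b\<^bsub>jk\<^esub> = (t\<^bsub>ij\<^esub> a\<^bsub>ij\<^esub>) (t\<^bsub>jk\<^esub> b\<^bsub>jk\<^esub>)\<close> summed over \<open>j\<close>.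
  Conversely, comparing entries in \<open>\<Theta>\<^sub>T 1 = 1\<close> and in
  \<open>\<Theta>\<^sub>T (E\<^bsub>ij\<^esub> E\<^bsub>jk\<^esub>) = \<Theta>\<^sub>T E\<^bsub>ij\<^esub> \<cdot> \<Theta>\<^sub>T E\<^bsub>jk\<^esub>\<close> gives transitivity.
\<close>

lemma ring_center_commute: "z \<in> ring_center \<Longrightarrow> z * x = x * z"
  by (simp add: ring_center_def)

lemma index_mat_in_center:
  fixes T :: "'a :: {ring, monoid_mult} mat"
  assumes "T \<in> carrier_mat n n" "elements_mat T \<subseteq> ring_center" "i < n" "j < n"
  shows "T $$ (i, j) \<in> ring_center"
  using assms by (meson elements_matI subsetD)

lemma hadamard_carrier [simp]:
  "T \<in> carrier_mat m n \<Longrightarrow> hadamard T A \<in> carrier_mat m n"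
  by (auto simp: hadamard_def)

lemma index_hadamard [simp]:
  "T \<in> carrier_mat m n \<Longrightarrow> i < m \<Longrightarrow> j < n \<Longrightarrow> hadamard T A $$ (i, j) = T $$ (i, j) * A $$ (i, j)"
  by (auto simp: hadamard_def)

lemma transitive_mat_iff:
  assumes "T \<in> carrier_mat n n"
  shows "transitive_mat T \<longleftrightarrow>
    (\<forall>i<n. T $$ (i, i) = 1) \<and> (\<forall>i<n. \<forall>j<n. \<forall>k<n. T $$ (i, j) * T $$ (j, k) = T $$ (i, k))"
  using assms by (auto simp: transitive_mat_def)

text \<open>Product entries as explicit sums rather than scalar products of a row and a column, so
  that entries of \<open>T\<close> can be distributed over the terms.\<close>

lemma index_mult_mat_sum:
  assumes "A \<in> carrier_mat m n" "B \<in> carrier_mat n p" "i < m" "k < p"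
  shows "(A * B) $$ (i, k) = (\<Sum>j<n. A $$ (i, j) * B $$ (j, k))"
  using assms by (auto simp: scalar_prod_def atLeast0LessThan intro!: sum.cong)

lemma hadamard_mult:
  fixes T :: "'a :: {ring, monoid_mult} mat"
  assumes T: "T \<in> carrier_mat n n" "elements_mat T \<subseteq> ring_center" "transitive_mat T"
    and A: "A \<in> carrier_mat n n" and B: "B \<in> carrier_mat n n"
  shows "hadamard T (A * B) = hadamard T A * hadamard T B"
proof (rule eq_matI)
  fix i k assume "i < dim_row (hadamard T A * hadamard T B)" "k < dim_col (hadamard T A * hadamard T B)"
  then have ik: "i < n" "k < n" using T by (auto simp: hadamard_def)
  have "T $$ (i, k) * (A $$ (i, j) * B $$ (j, k))
      = (T $$ (i, j) * A $$ (i, j)) * (T $$ (j, k) * B $$ (j, k))" if j: "j < n" for j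
  proof -
    have "T $$ (i, k) = T $$ (i, j) * T $$ (j, k)"
      using T ik j by (simp add: transitive_mat_iff[OF T(1)])
    \<comment> \<open>Centrality of the entries of \<open>T\<close> enters here: the second factor
      of t_ij t_jk has to pass a_ij to reach b_jk.\<close>
    moreover have "T $$ (j, k) * A $$ (i, j) = A $$ (i, j) * T $$ (j, k)"
      using index_mat_in_center[OF T(1,2) j ik(2)] by (rule ring_center_commute)
    \<comment> \<open>The reversed instance of associativity puts t_jk next to a_ij, where the
      commutation can rewrite them.\<close>
    ultimately show ?thesis by (simp add: mult.assoc flip: mult.assoc[of "T $$ (j, k)" "A $$ (i, j)"])
  qed
  then have "T $$ (i, k) * (\<Sum>j<n. A $$ (i, j) * B $$ (j, k))
      = (\<Sum>j<n. (T $$ (i, j) * A $$ (i, j)) * (T $$ (j, k) * B $$ (j, k)))"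
    by (simp add: sum_distrib_left)
  then show "hadamard T (A * B) $$ (i, k) = (hadamard T A * hadamard T B) $$ (i, k)"
    using T A B ik
    by (simp add: index_mult_mat_sum[of _ n n _ n] del: index_mult_mat)
qed (use T A B in \<open>auto simp: hadamard_def\<close>)

lemma hadamard_bij_betw:
  fixes T :: "'a :: {ring, monoid_mult} mat"
  assumes T: "T \<in> carrier_mat n n" "transitive_mat T"
  shows "bij_betw (hadamard T) (carrier_mat n n) (carrier_mat n n)"
proof -
  \<comment> \<open>Since t_ij t_ji = t_ii = 1. With i and j free to swap, this covers both
    compositions with the transpose.\<close>
  have inv: "T $$ (i, j) * (T $$ (j, i) * x) = x" if "i < n" "j < n" for i j x
    using T that by (simp add: transitive_mat_iff[OF T(1)] flip: mult.assoc)
  show ?thesis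
    by (rule bij_betw_byWitness[where f' = "hadamard (transpose_mat T)"])
      (use T(1) inv in \<open>auto intro!: eq_matI simp: hadamard_def\<close>)
qed

lemma transitive_mat_if_hadamard_mult:
  fixes T :: "'a :: {ring, monoid_mult} mat"
  assumes T: "T \<in> carrier_mat n n"
    and one: "hadamard T (1\<^sub>m n) = 1\<^sub>m n"
    and mult: "\<And>A B. A \<in> carrier_mat n n \<Longrightarrow> B \<in> carrier_mat n n \<Longrightarrow>
      hadamard T (A * B) = hadamard T A * hadamard T B"
  shows "transitive_mat T"
  unfolding transitive_mat_iff[OF T]
proof (intro conjI allI impI)
  fix i assume "i < n"
  then show "T $$ (i, i) = 1"
    using arg_cong[OF one, of "\<lambda>M. M $$ (i, i)"] T by simp
next
  fix i j k assume ijk: "i < n" "j < n" "k < n"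
  \<comment> \<open>The matrix units; the (i, k) entry of the image of \<open>E i j * E j k\<close>
    isolates the wanted relation.\<close>
  define E :: "nat \<Rightarrow> nat \<Rightarrow> 'a mat"
    where "E p q = mat n n (\<lambda>ij. if ij = (p, q) then 1 else 0)" for p q
  have E: "E p q \<in> carrier_mat n n" for p q by (simp add: E_def)
  have "T $$ (i, k) * (\<Sum>l<n. E i j $$ (i, l) * E j k $$ (l, k))
      = (\<Sum>l<n. (T $$ (i, l) * E i j $$ (i, l)) * (T $$ (l, k) * E j k $$ (l, k)))"
    using arg_cong[OF mult[OF E E], of "\<lambda>M. M $$ (i, k)" i j j k] T E ijk
    by (simp add: index_mult_mat_sum[of _ n n _ n] del: index_mult_mat)
  \<comment> \<open>Both sums collapse to their term at l = j, leaving t_ik on the left and t_ij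
    t_jk on the right.\<close>
  moreover have "E i j $$ (i, l) * E j k $$ (l, k) = (if l = j then 1 else 0)"
    "(T $$ (i, l) * E i j $$ (i, l)) * (T $$ (l, k) * E j k $$ (l, k))
      = (if l = j then T $$ (i, j) * T $$ (j, k) else 0)" if "l < n" for l
    using that ijk by (auto simp: E_def)
  ultimately show "T $$ (i, j) * T $$ (j, k) = T $$ (i, k)"
    using ijk by simp
qed

theorem proposition3p1:
  fixes T :: "'a :: {ring, monoid_mult} mat" and n :: nat
  assumes "n \<ge> 1"
    and "T \<in> carrier_mat n n"
    and "elements_mat T \<subseteq> ring_center"
  shows "transitive_mat T \<longleftrightarrow>
    algebra_automorphism ring_center (matrix_algebra TYPE('a) n) (\<lambda>A. hadamard T A)"
proof
  assume tr: "transitive_mat T"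
  have "hadamard T (A + B) = hadamard T A + hadamard T B"
    if "A \<in> carrier_mat n n" "B \<in> carrier_mat n n" for A B
    using assms(2) that by (auto intro!: eq_matI simp: hadamard_def distrib_left)
  moreover have "hadamard T (1\<^sub>m n) = 1\<^sub>m n"
    using assms(2) tr by (auto intro!: eq_matI simp: hadamard_def transitive_mat_iff[OF assms(2)])
  moreover have "hadamard T (c \<cdot>\<^sub>m A) = c \<cdot>\<^sub>m hadamard T A"
    if c: "c \<in> ring_center" and A: "A \<in> carrier_mat n n" for c A
  proof -
    \<comment> \<open>Here it is the scalar c that is central, so t may be arbitrary.\<close>
    have "t * (c * a) = c * (t * a)" for t a
      by (simp only: mult.assoc[symmetric] ring_center_commute[OF c, of t])
    then show ?thesis
      using assms(2) A by (auto intro!: eq_matI simp: hadamard_def)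
  qed
  ultimately show "algebra_automorphism ring_center (matrix_algebra TYPE('a) n) (hadamard T)"
    using assms(2) hadamard_mult[OF assms(2,3) tr] hadamard_bij_betw[OF assms(2) tr]
    by (auto simp: algebra_automorphism_def matrix_algebra_def ring_iso_def Ring.ring_hom_def)
next
  assume "algebra_automorphism ring_center (matrix_algebra TYPE('a) n) (hadamard T)"
  then show "transitive_mat T"
    by (intro transitive_mat_if_hadamard_mult[OF assms(2)])
      (auto simp: algebra_automorphism_def matrix_algebra_def ring_iso_def Ring.ring_hom_def)
qed

end
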